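(* Let $J:\mathbb{R}^N\to\mathbb{R}$ be a finite-valued convex function, $\Phi\in\mathbb{R}^{Q\times N}$, $y\in\mathbb{R}^Q$, $\lambda>0$. Let $x$ be a solution of $$(\mathcal P_\lambda(y))\qquad \min_{z\in\mathbb{R}^N}\tfrac12\|y-\Phi z\|^2+\lambda J(z)$$ (respectively, a feasible point of $(\mathcal P_0(y))$: $\min_{z\in\mathbb{R}^N} J(z)$ subject to $\Phi z=y$). Assume that there exists $\alpha\in\mathbb{R}^Q$ such that $\Phi^*\alpha\in\operatorname{ri}(\partial J(x))$, and that $\operatorname{Ker}(\Phi)\cap T_x=\{0\}$. Then $x$ is the unique solution of $(\mathcal P_\lambda(y))$ (respectively, of $(\mathcal P_0(y))$).
   Context: For a finite-valued convex function $J$ on $\mathbb{R}^N$ and $x\in\mathbb{R}^N$: let $\bar S_x$ be the affine hull of $\partial J(x)$, $e_x$ the orthogonal projection of $0$ onto $\bar S_x$, $S_x=\bar S_x-e_x$ (a linear subspace). The model subspace of $x$ is $T_x=S_x^\perp$. $\operatorname{ri}$ is the relative interior. *)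

theory Defs
  imports "HOL-Analysis.Analysis"
begin

definition subdifferential :: "('a::real_inner \<Rightarrow> real) \<Rightarrow> 'a \<Rightarrow> 'a set" where
  "subdifferential J x = {u. \<forall>z. J x + u \<bullet> (z - x) \<le> J z}"

definition subdiff_hull :: "('a::euclidean_space \<Rightarrow> real) \<Rightarrow> 'a \<Rightarrow> 'a set" where
  "subdiff_hull J x = affine hull (subdifferential J x)"

text \<open>The projection is well defined for finite-valued convex functions: the subdifferential
  is then nonempty, and affine subspaces of a Euclidean space are closed and convex.\<close>

definition model_vector :: "('a::euclidean_space \<Rightarrow> real) \<Rightarrow> 'a \<Rightarrow> 'a" where
  "model_vector J x = closest_point (subdiff_hull J x) 0"

definition subdiff_direction :: "('a::euclidean_space \<Rightarrow> real) \<Rightarrow> 'a \<Rightarrow> 'a set" where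
  "subdiff_direction J x = (\<lambda>u. u - model_vector J x) ` subdiff_hull J x"

definition model_subspace :: "('a::euclidean_space \<Rightarrow> real) \<Rightarrow> 'a \<Rightarrow> 'a set" where
  "model_subspace J x = orthogonal_comp (subdiff_direction J x)"

definition penalized_objective ::
  "(real^'n \<Rightarrow> real) \<Rightarrow> real^'n^'q \<Rightarrow> real^'q \<Rightarrow> real \<Rightarrow> real^'n \<Rightarrow> real" where
  "penalized_objective J \<Phi> y l z = 1/2 * (norm (y - \<Phi> *v z))\<^sup>2 + l * J z"

definition is_solution_P ::
  "(real^'n \<Rightarrow> real) \<Rightarrow> real^'n^'q \<Rightarrow> real^'q \<Rightarrow> real \<Rightarrow> real^'n \<Rightarrow> bool" where
  "is_solution_P J \<Phi> y l x \<longleftrightarrow> is_arg_min (penalized_objective J \<Phi> y l) (\<lambda>z. True) x"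

text \<open>The noiseless problem is a separate constrained problem, not the penalized problem with
  parameter zero.\<close>

definition is_feasible_P0 :: "real^'n^'q \<Rightarrow> real^'q \<Rightarrow> real^'n \<Rightarrow> bool" where
  "is_feasible_P0 \<Phi> y z \<longleftrightarrow> \<Phi> *v z = y"

definition is_solution_P0 ::
  "(real^'n \<Rightarrow> real) \<Rightarrow> real^'n^'q \<Rightarrow> real^'q \<Rightarrow> real^'n \<Rightarrow> bool" where
  "is_solution_P0 J \<Phi> y x \<longleftrightarrow> is_arg_min J (is_feasible_P0 \<Phi> y) x"

end

theory Submission
  imports Defs
begin

text \<open>Write \<open>u = \<Phi>\<^sup>T \<alpha>\<close> for the given point of the relative interior of the subdifferential.
  Moving away from \<open>u\<close> inside the affine hull in any direction stays in the
  subdifferential for a short while, so for a displacement \<open>h\<close> outside the model subspace (that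
  is, not orthogonal to all directions of the affine hull) some subgradient \<open>v\<close> satisfies \<open>v \<bullet> h > u \<bullet> h\<close>. Hence the
  subgradient inequality at \<open>u\<close> is strict along \<open>h\<close>; this is
  \<open>subgradient_inequality_strict\<close>.

  If \<open>h\<close> is a nonzero element of the kernel of \<open>\<Phi>\<close>, it lies outside the model subspace, and
  \<open>u \<bullet> h = \<alpha> \<bullet> \<Phi> h = 0\<close>. So \<open>J\<close> increases strictly when one leaves \<open>x\<close> inside its fibre of \<open>\<Phi>\<close>
  (\<open>strict_minimum_on_fibre\<close>). For the constrained problem this is already the claim, as the
  feasible set is that fibre. For the penalized problem, strict convexity of the squared norm
  makes all solutions have the same image under \<open>\<Phi>\<close>, and then the same value of \<open>J\<close>
  (\<open>penalized_solutions_same_image\<close>), so again a second solution cannot differ from \<open>x\<close>.\<close>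

text \<open>A relative interior point can be pushed a little along the line to any \<open>b\<close> in the affine hull,
  either towards \<open>b\<close> or away from it; the sign of the step is chosen to increase
  the inner product with \<open>h\<close>.\<close>

lemma rel_interior_not_maximal:
  fixes S :: "'a::euclidean_space set"
  assumes u: "u \<in> rel_interior S" and b: "b \<in> affine hull S" and ne: "b \<bullet> h \<noteq> u \<bullet> h"
  obtains v where "v \<in> S" "u \<bullet> h < v \<bullet> h"
proof -
  obtain e where e: "e > 0" "cball u e \<inter> affine hull S \<subseteq> S" and uS: "u \<in> S"
    using u by (auto simp: mem_rel_interior_cball)
  define d where "d = b - u"
  have dh: "d \<bullet> h \<noteq> 0"
    using ne by (simp add: d_def inner_diff_left)
  then have d0: "norm d > 0"
    by auto
  define t where "t = sgn (d \<bullet> h) * (e / norm d)"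
  define v where "v = u + t *\<^sub>R d"
  have "v = (1 - t) *\<^sub>R u + t *\<^sub>R b"
    by (simp add: v_def d_def algebra_simps)
  then have "v \<in> affine hull S"
    using mem_affine[OF affine_affine_hull hull_inc[OF uS] b, of "1 - t" t] by simp
  moreover have "v \<in> cball u e"
    using d0 e(1) dh by (simp add: v_def t_def dist_norm abs_mult abs_sgn_eq)
  ultimately have "v \<in> S"
    using e(2) by auto
  moreover have "t * (d \<bullet> h) = \<bar>d \<bullet> h\<bar> * (e / norm d)"
    by (simp add: t_def abs_sgn)
  then have "u \<bullet> h < v \<bullet> h"
    using dh d0 e(1) by (simp add: v_def inner_add_left)
  ultimately show thesis
    using that by blast
qed

text \<open>If \<open>h\<close> is not in the model subspace, then the affine hull of the subdifferential is not contained
  in the hyperplane through \<open>u\<close> orthogonal to \<open>h\<close>. A point of the hull off this hyperplane shows that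
  \<open>u\<close> does not maximise \<open>v \<bullet> h\<close> over the subgradients \<open>v\<close>.\<close>

lemma subgradient_inequality_strict:
  fixes J :: "'a::euclidean_space \<Rightarrow> real"
  assumes u: "u \<in> rel_interior (subdifferential J x)" and h: "h \<notin> model_subspace J x"
  shows "J x + u \<bullet> h < J (x + h)"
proof -
  let ?A = "subdiff_hull J x" and ?e = "model_vector J x"
  have "u \<in> ?A"
    unfolding subdiff_hull_def by (intro hull_inc subsetD[OF rel_interior_subset u])
  then have "?e \<in> ?A"
    unfolding model_vector_def subdiff_hull_def
    by (intro closest_point_in_set closed_affine_hull) auto
  moreover obtain a where "a \<in> ?A" "(a - ?e) \<bullet> h \<noteq> 0"
    using h by (auto simp: model_subspace_def subdiff_direction_def orthogonal_comp_def
        orthogonal_def)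
  \<comment> \<open>The inner products of \<open>a\<close> and \<open>?e\<close> with \<open>h\<close> differ, so they cannot both equal that of \<open>u\<close>.\<close>
  ultimately obtain b where "b \<in> ?A" "b \<bullet> h \<noteq> u \<bullet> h"
    by (cases "a \<bullet> h = u \<bullet> h") (auto simp: inner_diff_left)
  then obtain v where v: "v \<in> subdifferential J x" "u \<bullet> h < v \<bullet> h"
    using rel_interior_not_maximal[OF u, of b h] unfolding subdiff_hull_def by auto
  from v(1) have "J x + v \<bullet> (x + h - x) \<le> J (x + h)"
    unfolding subdifferential_def mem_Collect_eq by (rule spec)
  with v(2) show ?thesis
    by simp
qed

lemma strict_minimum_on_fibre:
  fixes J :: "real^'n \<Rightarrow> real" and \<Phi> :: "real^'n^'q"
  assumes u: "transpose \<Phi> *v \<alpha> \<in> rel_interior (subdifferential J x)"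
    and ker: "{z. \<Phi> *v z = 0} \<inter> model_subspace J x = {0}"
    and eq: "\<Phi> *v z = \<Phi> *v x" and ne: "z \<noteq> x"
  shows "J x < J z"
proof -
  have h: "\<Phi> *v (z - x) = 0"
    using eq by (simp add: matrix_vector_mult_diff_distrib)
  have "z - x \<notin> {0}"
    using ne by simp
  then have "z - x \<notin> model_subspace J x"
    unfolding ker[symmetric] using h by simp
  moreover have "(transpose \<Phi> *v \<alpha>) \<bullet> (z - x) = 0"
    by (simp only: transpose_matrix_vector dot_lmul_matrix h inner_zero_right)
  ultimately show ?thesis
    using subgradient_inequality_strict[OF u, of "z - x"] by simp
qed

text \<open>At the midpoint of two solutions, \<open>J\<close> is at most the average of its two values by convexity, while
  by the parallelogram identity the quadratic term falls below its average by a multiple of the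
  squared distance between the two images. Optimality forces that distance to be zero.\<close>

lemma penalized_solutions_same_image:
  assumes conv: "convex_on UNIV J" and l: "l > 0"
    and x: "is_solution_P J \<Phi> y l x" and z: "is_solution_P J \<Phi> y l z"
  shows "\<Phi> *v z = \<Phi> *v x" and "J z = J x"
proof -
  let ?f = "penalized_objective J \<Phi> y l"
  define m where "m = (1/2) *\<^sub>R x + (1/2) *\<^sub>R z"
  define a where "a = y - \<Phi> *v x"
  define b where "b = y - \<Phi> *v z"
  have least: "?f x \<le> ?f w" "?f z \<le> ?f w" for w
    using x z by (simp_all add: is_solution_P_def is_arg_min_linorder)
  have min: "?f x \<le> ?f m"
    by (rule least)
  have fxz: "?f x = ?f z"
    by (rule antisym) (rule least)+
  have "J m \<le> (1/2) * J x + (1/2) * J z"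
    using convex_onD[OF conv, of "1/2" x z] by (simp add: m_def)
  from mult_left_mono[OF this, of l] have Jm: "l * J m \<le> (1/2) * (l * J x) + (1/2) * (l * J z)"
    using l by (simp add: algebra_simps)
  have "y - \<Phi> *v m = (1/2) *\<^sub>R (a + b)"
    by (simp add: m_def a_def b_def matrix_vector_right_distrib matrix_vector_mult_scaleR
        vec_eq_iff field_simps)
  then have "(norm (y - \<Phi> *v m))\<^sup>2 = (norm a)\<^sup>2 / 2 + (norm b)\<^sup>2 / 2 - (norm (a - b))\<^sup>2 / 4"
    by (simp add: power2_norm_eq_inner inner_add_left inner_add_right
        inner_diff_left inner_diff_right inner_commute field_simps)
  then have "(norm (a - b))\<^sup>2 \<le> 0"
    using min fxz Jm unfolding penalized_objective_def a_def b_def by linarith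
  then show image: "\<Phi> *v z = \<Phi> *v x"
    by (simp add: a_def b_def)
  show "J z = J x"
    using fxz image l by (simp add: penalized_objective_def)
qed

theorem corollary1:
  fixes J :: "real^'n \<Rightarrow> real" and \<Phi> :: "real^'n^'q" and y :: "real^'q"
    and l :: real and x :: "real^'n"
  assumes "convex_on UNIV J"
    and "l > 0"
    and "\<exists>\<alpha>. transpose \<Phi> *v \<alpha> \<in> rel_interior (subdifferential J x)"
    and "{z. \<Phi> *v z = 0} \<inter> model_subspace J x = {0}"
  shows "(is_solution_P J \<Phi> y l x \<longrightarrow>
            is_solution_P J \<Phi> y l x \<and> (\<forall>z. is_solution_P J \<Phi> y l z \<longrightarrow> z = x)) \<and>
         (is_feasible_P0 \<Phi> y x \<longrightarrow>
            is_solution_P0 J \<Phi> y x \<and> (\<forall>z. is_solution_P0 J \<Phi> y z \<longrightarrow> z = x))"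
proof -
  have strict: "J x < J z" if "\<Phi> *v z = \<Phi> *v x" "z \<noteq> x" for z
    using assms(3,4) that strict_minimum_on_fibre by blast
  have "z = x" if "is_solution_P J \<Phi> y l x" "is_solution_P J \<Phi> y l z" for z
    using penalized_solutions_same_image[OF assms(1,2) that] strict[of z] by auto
  moreover have "is_solution_P0 J \<Phi> y x \<and> (\<forall>z. is_solution_P0 J \<Phi> y z \<longrightarrow> z = x)"
    if "is_feasible_P0 \<Phi> y x"
  proof (intro conjI allI impI)
    have fibre: "\<Phi> *v z = \<Phi> *v x" if "is_feasible_P0 \<Phi> y z" for z
      using that \<open>is_feasible_P0 \<Phi> y x\<close> by (simp add: is_feasible_P0_def)
    have "J x \<le> J z" if "is_feasible_P0 \<Phi> y z" for z
      using strict[OF fibre[OF that]] by (cases "z = x") auto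
    then show "is_solution_P0 J \<Phi> y x"
      using that by (simp add: is_solution_P0_def is_arg_min_linorder)
    fix z
    assume "is_solution_P0 J \<Phi> y z"
    then have feasible: "is_feasible_P0 \<Phi> y z" and "J z \<le> J x"
      using that by (simp_all add: is_solution_P0_def is_arg_min_linorder)
    then show "z = x"
      using strict[OF fibre[OF feasible]] by (cases "z = x") auto
  qed
  ultimately show ?thesis
    by blast
qed

end
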